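(* Let $p,m\ge 1$ be integers. Suppose that indicators $Y^t=(Y_1^t,\dots,Y_p^t)'$ at times $t=0,1,2,\dots$ are related to $m$ latent factors $\eta^t=(\eta_1^t,\dots,\eta_m^t)'$ by $Y^t=\Lambda\eta^t+\varepsilon$, where $\Lambda$ is a fixed $p\times m$ matrix and $\varepsilon$ is a $p\times1$ vector of independent normally distributed random variables, and that for $t\ge1$, $\eta^t=B\eta^{t-1}+W^t$, where $B$ is a fixed $m\times m$ real matrix and the $m\times1$ random vectors $W^t$ are independently normally distributed with potentially distinct parameters at each $t$. Suppose that (i) as $t\to\infty$, $Y^t$ converges in distribution to some random variable $Y^*$; (ii) $B$ is invertible; (iii) the random variables $W^t$ decay sufficiently quickly that, as $t\to\infty$, $\sum_{k=1}^{t}B^{-k}W^k$ converges in distribution to some normally distributed random variable $W^*$. Let $\sim$ be the equivalence relation on $\{1,\dots,m\}$ defined by: $i\sim j$ if and only if there exist $k_1,\dots,k_v\in\{1,\dots,m\}$ with $k_1=i$, $k_v=j$ and, for all $r\in\{2,\dots,v\}$, $B_{k_rk_{r-1}}\ne0$ or $B_{k_{r-1}k_r}\ne0$. Let $C_1,\dots,C_q$ be the equivalence classes, let $B_r$ be the submatrix of $B$ with rows and columns indexed by $C_r$ (so that, after permuting indices, $B$ is block diagonal with blocks $B_1,\dots,B_q$), and let $D_r$ be the Jordan normal form of $B_r$. If the class $C_r$ satisfies at least one of the following: (a) $C_r$ consists of exactly one factor; (b) $C_r$ consists of exactly two factors; (c) each factor in $C_r$ positively affects the others, in the sense that all entries of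 $B_r$ are strictly positive; then the class $C_r$ gives rise, in the limit $t\to\infty$, to at most a single factor, i.e. it contributes at most $1$ to the rank of $D^*$: $\operatorname{rank}\left(\lim_{t\to\infty}D_r^t\right)\le 1$.
   Context: Here a prime denotes transpose. The superscript $t$ on $Y^t,\eta^t,W^t$ is a time index, while $B^t$, $D_r^t$, $B^{-k}$ denote matrix powers. The $(i,j)$ entry of $B$ represents the causal effect on factor $i$ at time $t$ of factor $j$ at time $t-1$. $D$ denotes the Jordan normal form of $B$ (block diagonal with blocks $D_1,\dots,D_q$ after permuting indices) and $D^*=\lim_{t\to\infty}D^t$; $\operatorname{rank}(D^* )$ is the number of factors in the limiting factor model $Y^*=\Lambda^*\eta^*+\varepsilon$.
   Formalization: The limit of D_r^t need not exist under (i)–(iii) (e.g. m=p=1, B=-1, W^1 normal, later W^k=0), so the rank bound is stated whenever that limit exists; if D*=lim D^t exists, the limit of D_r^t is also shown to exist. *)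

theory Defs
  imports
    "HOL-Probability.Probability"
    "Jordan_Normal_Form.Jordan_Normal_Form"
    "Jordan_Normal_Form.DL_Rank"
begin

no_notation Matrix.vec_index (infixl \<open>$\<close> 100)
no_notation Matrix.scalar_prod (infix \<open>\<bullet>\<close> 70)

text \<open>
  Convergence in distribution. The library's \<open>weak_conv_m\<close> only covers measures on the
  reals. The limit \<open>Z\<close> may live on a different probability space \<open>N\<close>.
\<close>

definition conv_in_distr ::
  "'a measure \<Rightarrow> (nat \<Rightarrow> 'a \<Rightarrow> 'v::topological_space) \<Rightarrow> 'b measure \<Rightarrow> ('b \<Rightarrow> 'v) \<Rightarrow> bool"
  where
  "conv_in_distr M X N Z \<longleftrightarrow>
     (\<forall>f :: 'v \<Rightarrow> real. continuous_on UNIV f \<and> bounded (range f) \<longrightarrow>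
        (\<lambda>n. \<integral>\<omega>. f (X n \<omega>) \<partial>M) \<longlonglongrightarrow> (\<integral>\<omega>. f (Z \<omega>) \<partial>N))"

text \<open>
  Normal laws may be degenerate (variance \<open>0\<close>), so that, for instance, \<open>W\<^sup>t = 0\<close> is allowed.
  A random vector is normal iff all its one-dimensional projections are.
\<close>

definition normal_rv :: "'a measure \<Rightarrow> ('a \<Rightarrow> real) \<Rightarrow> bool" where
  "normal_rv M X \<longleftrightarrow> X \<in> borel_measurable M \<and>
     ((\<exists>\<mu>. AE \<omega> in M. X \<omega> = \<mu>) \<or>
      (\<exists>\<mu> \<sigma>. 0 < \<sigma> \<and> distributed M lborel X (normal_density \<mu> \<sigma>)))"

definition normal_rvec :: "'a measure \<Rightarrow> ('a \<Rightarrow> real ^ 'n) \<Rightarrow> bool" where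
  "normal_rvec M X \<longleftrightarrow> X \<in> borel_measurable M \<and> (\<forall>a. normal_rv M (\<lambda>\<omega>. a \<bullet> X \<omega>))"

text \<open>The operation \<open>^\<close> on \<^typ>\<open>real ^ 'n ^ 'n\<close> is componentwise, hence the following.\<close>

primrec mpow :: "real ^ 'n ^ 'n \<Rightarrow> nat \<Rightarrow> real ^ 'n ^ 'n" where
  "mpow A 0 = Finite_Cartesian_Product.mat 1"
| "mpow A (Suc k) = A ** mpow A k"

definition factor_rel :: "real ^ 'm ^ 'm \<Rightarrow> ('m \<times> 'm) set" where
  "factor_rel B = {(i, j). \<exists>ks. ks \<noteq> [] \<and> hd ks = i \<and> last ks = j \<and>
     (\<forall>r\<in>{1..<length ks}. B $ (ks ! r) $ (ks ! (r - 1)) \<noteq> 0 \<or> B $ (ks ! (r - 1)) $ (ks ! r) \<noteq> 0)}"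

text \<open>
  The submatrix with rows and columns indexed by \<open>set xs\<close>, in the order given by the
  duplicate-free list \<open>xs\<close>, regarded as a complex matrix so that it has a Jordan normal form.
\<close>

definition principal_submat :: "real ^ 'm ^ 'm \<Rightarrow> 'm list \<Rightarrow> complex mat" where
  "principal_submat B xs = Matrix.mat (length xs) (length xs)
     (\<lambda>(a, b). complex_of_real (B $ (xs ! a) $ (xs ! b)))"

text \<open>The Jordan normal form is unique only up to the order of the Jordan blocks.\<close>

definition is_jordan_form_of :: "complex mat \<Rightarrow> complex mat \<Rightarrow> bool" where
  "is_jordan_form_of J A \<longleftrightarrow> (\<exists>n_as. jordan_nf A n_as \<and> J = jordan_matrix n_as)"

definition mat_tendsto :: "(nat \<Rightarrow> complex mat) \<Rightarrow> complex mat \<Rightarrow> bool" where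
  "mat_tendsto X L \<longleftrightarrow>
     (\<forall>t. X t \<in> carrier_mat (dim_row L) (dim_col L)) \<and>
     (\<forall>i<dim_row L. \<forall>j<dim_col L. (\<lambda>t. X t $$ (i, j)) \<longlonglongrightarrow> L $$ (i, j))"

definition mat_rank :: "complex mat \<Rightarrow> nat" where
  "mat_rank A = vec_space.rank (dim_row A) A"

end

theory Submission
  imports Defs
begin

text \<open>
  The block \<open>B\<^sub>r\<close> is similar to \<open>D\<^sub>r\<close>, so \<open>D\<^sub>r\<^sup>t\<close> converges iff \<open>B\<^sub>r\<^sup>t\<close> does, and the limits are
  similar. The limit \<open>L\<close> of \<open>B\<^sub>r\<^sup>t\<close> satisfies \<open>B\<^sub>r L = L\<close>, that is, its columns are fixed vectors
  of \<open>B\<^sub>r\<close>. For two factors, connectedness provides a nonzero off-diagonal entry of \<open>B\<^sub>r\<close>,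
  so the fixed space is at most a line. For positive \<open>B\<^sub>r\<close>, the limit \<open>L\<close> is nonnegative,
  and subtracting from a fixed vector the largest multiple of a positive fixed vector that leaves
  it nonnegative produces a nonnegative fixed vector with a zero entry, which must vanish.
  Finally, since \<open>B\<close> is block diagonal, \<open>B\<^sub>r\<^sup>t\<close> is the block of \<open>B\<^sup>t\<close>, so it converges whenever
  \<open>D\<^sup>t\<close> does.
\<close>

section \<open>Rank at most one as a factorisation of entries\<close>

text \<open>Rank at most one is encoded by factored entries because this form survives
  multiplication by a matrix on either side, and hence a change of basis.\<close>

definition outer_product_mat :: "complex mat \<Rightarrow> bool" where
  "outer_product_mat L \<longleftrightarrow> (\<exists>v f. \<forall>i<dim_row L. \<forall>j<dim_col L. L $$ (i, j) = v i * f j)"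

lemma mat_rank_le_1:
  assumes "outer_product_mat L"
  shows "mat_rank L \<le> 1"
proof -
  obtain v f where "\<And>i j. i < dim_row L \<Longrightarrow> j < dim_col L \<Longrightarrow> L $$ (i, j) = v i * f j"
    using assms unfolding outer_product_mat_def by blast
  then show ?thesis
    unfolding mat_rank_def
    by (intro vec_space.rank_le_1_product_entries[of L "dim_row L" "dim_col L" v f]) auto
qed

lemma mult_mat_entry:
  assumes "A \<in> carrier_mat n k" "X \<in> carrier_mat k m" "i < n" "j < m"
  shows "(A * X) $$ (i, j) = (\<Sum>l<k. A $$ (i, l) * X $$ (l, j))"
  using assms by (auto simp: scalar_prod_def atLeast0LessThan)

lemma outer_product_mult_left:
  assumes L: "outer_product_mat L" "L \<in> carrier_mat n m" and P: "P \<in> carrier_mat k n"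
  shows "outer_product_mat (P * L)"
proof -
  obtain v f where vf: "\<And>i j. i < n \<Longrightarrow> j < m \<Longrightarrow> L $$ (i, j) = v i * f j"
    using L unfolding outer_product_mat_def by blast
  have "(P * L) $$ (i, j) = (\<Sum>l<n. P $$ (i, l) * v l) * f j" if "i < k" "j < m" for i j
    using that vf by (simp add: mult_mat_entry[OF P L(2)] sum_distrib_right mult.assoc)
  then show ?thesis
    unfolding outer_product_mat_def using P L(2)
    by - (rule exI[of _ "\<lambda>i. \<Sum>l<n. P $$ (i, l) * v l"], rule exI[of _ f], auto)
qed

lemma outer_product_mult_right:
  assumes L: "outer_product_mat L" "L \<in> carrier_mat n m" and Q: "Q \<in> carrier_mat m k"
  shows "outer_product_mat (L * Q)"
proof -
  obtain v f where vf: "\<And>i j. i < n \<Longrightarrow> j < m \<Longrightarrow> L $$ (i, j) = v i * f j"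
    using L unfolding outer_product_mat_def by blast
  have "(L * Q) $$ (i, j) = v i * (\<Sum>l<m. f l * Q $$ (l, j))" if "i < n" "j < k" for i j
    using that vf by (simp add: mult_mat_entry[OF L(2) Q] sum_distrib_left mult.assoc)
  then show ?thesis
    unfolding outer_product_mat_def using Q L(2)
    by - (rule exI[of _ v], rule exI[of _ "\<lambda>j. \<Sum>l<m. f l * Q $$ (l, j)"], auto)
qed

section \<open>Entrywise limits of matrices\<close>

lemma mat_tendsto_entry:
  assumes "mat_tendsto X L" "L \<in> carrier_mat n m" "i < n" "j < m"
  shows "(\<lambda>t. X t $$ (i, j)) \<longlonglongrightarrow> L $$ (i, j)"
  using assms unfolding mat_tendsto_def by auto

lemma mat_tendsto_unique:
  assumes "mat_tendsto X L" "mat_tendsto X L'" "L \<in> carrier_mat n m" "L' \<in> carrier_mat n m"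
  shows "L = L'"
  using assms by (intro eq_matI) (auto intro: LIMSEQ_unique mat_tendsto_entry)

lemma mat_tendsto_Suc:
  assumes "mat_tendsto X L"
  shows "mat_tendsto (\<lambda>t. X (Suc t)) L"
  using assms unfolding mat_tendsto_def by (auto intro: LIMSEQ_Suc)

lemma mat_tendsto_mult_left:
  assumes X: "mat_tendsto X L" and L: "L \<in> carrier_mat n m" and P: "P \<in> carrier_mat k n"
  shows "mat_tendsto (\<lambda>t. P * X t) (P * L)"
proof -
  have X': "X t \<in> carrier_mat n m" for t
    using X L unfolding mat_tendsto_def by auto
  have "(\<lambda>t. (P * X t) $$ (i, j)) \<longlonglongrightarrow> (P * L) $$ (i, j)" if "i < k" "j < m" for i j
    unfolding mult_mat_entry[OF P L that] mult_mat_entry[OF P X' that]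
    by (intro tendsto_intros mat_tendsto_entry[OF X L]) (use that in auto)
  then show ?thesis
    unfolding mat_tendsto_def using P L mult_carrier_mat[OF P X'] by auto
qed

lemma mat_tendsto_mult_right:
  assumes X: "mat_tendsto X L" and L: "L \<in> carrier_mat n m" and Q: "Q \<in> carrier_mat m k"
  shows "mat_tendsto (\<lambda>t. X t * Q) (L * Q)"
proof -
  have X': "X t \<in> carrier_mat n m" for t
    using X L unfolding mat_tendsto_def by auto
  have "(\<lambda>t. (X t * Q) $$ (i, j)) \<longlonglongrightarrow> (L * Q) $$ (i, j)" if "i < n" "j < k" for i j
    unfolding mult_mat_entry[OF L Q that] mult_mat_entry[OF X' Q that]
    by (intro tendsto_intros mat_tendsto_entry[OF X L]) (use that in auto)
  then show ?thesis
    unfolding mat_tendsto_def using Q L mult_carrier_mat[OF X' Q] by auto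
qed

section \<open>Limits of matrix powers\<close>

lemma mat_tendsto_pow_dim:
  assumes "mat_tendsto (\<lambda>t. A ^\<^sub>m t) L" "A \<in> carrier_mat n n"
  shows "L \<in> carrier_mat n n"
proof -
  \<comment> \<open>All powers share the shape of the limit, so the zeroth one already reveals
    it.\<close>
  have "A ^\<^sub>m 0 \<in> carrier_mat (dim_row L) (dim_col L)"
    using assms(1) unfolding mat_tendsto_def by blast
  then show ?thesis using assms(2) unfolding carrier_mat_def by simp
qed

lemma pow_mat_Suc_left:
  assumes "(A :: 'a :: semiring_1 mat) \<in> carrier_mat n n"
  shows "A ^\<^sub>m Suc k = A * A ^\<^sub>m k"
proof (induction k)
  case 0
  then show ?case using assms by simp
next
  case (Suc k)
  have "A ^\<^sub>m Suc (Suc k) = A * A ^\<^sub>m k * A"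
    using Suc by simp
  also have "\<dots> = A * (A ^\<^sub>m k * A)"
    using assms by (intro assoc_mult_mat[of _ n n _ n _ n]) auto
  finally show ?case by simp
qed

text \<open>The shifted sequence of powers converges to \<open>A * L\<close>, by continuity of
  multiplication, and also to \<open>L\<close>; limits are unique.\<close>

lemma pow_limit_fixed:
  assumes lim: "mat_tendsto (\<lambda>t. A ^\<^sub>m t) L" and A: "A \<in> carrier_mat n n"
  shows "A * L = L"
proof -
  note L = mat_tendsto_pow_dim[OF lim A]
  show ?thesis
    using mat_tendsto_mult_left[OF lim L A] mat_tendsto_Suc[OF lim] A L
    unfolding pow_mat_Suc_left[OF A] by (intro mat_tendsto_unique[of _ _ _ n n]) auto
qed

lemma pow_limit_similar:
  assumes wit: "similar_mat_wit A J P Q" and lim: "mat_tendsto (\<lambda>t. J ^\<^sub>m t) L"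
  shows "mat_tendsto (\<lambda>t. A ^\<^sub>m t) (P * L * Q)"
proof -
  define n where "n = dim_row A"
  note w = similar_mat_witD[OF n_def wit]
  note L = mat_tendsto_pow_dim[OF lim w(5)]
  have "A ^\<^sub>m t = P * J ^\<^sub>m t * Q" for t
    using similar_mat_wit_pow[OF wit, of t] unfolding similar_mat_wit_def Let_def by blast
  then show ?thesis
    using mat_tendsto_mult_right[OF mat_tendsto_mult_left[OF lim L w(6)]
        mult_carrier_mat[OF w(6) L] w(7)]
    by (simp only:)
qed

text \<open>Conjugation turns the limit \<open>L\<close> for \<open>J\<close> into a limit
  \<open>K\<close> for \<open>A\<close>, and conjugating back recovers \<open>L\<close> from
  \<open>K\<close>. This moves the claim from the Jordan form to the class matrix, whose entries can
  be inspected.\<close>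

lemma outer_product_pow_limit_similar:
  assumes wit: "similar_mat_wit A J P Q" and lim: "mat_tendsto (\<lambda>t. J ^\<^sub>m t) L"
    and outer: "\<And>K. mat_tendsto (\<lambda>t. A ^\<^sub>m t) K \<Longrightarrow> outer_product_mat K"
  shows "outer_product_mat L"
proof -
  define n where "n = dim_row A"
  note w = similar_mat_witD[OF n_def wit]
  note L = mat_tendsto_pow_dim[OF lim w(5)]
  define K where "K = P * L * Q"
  have K: "K \<in> carrier_mat n n" unfolding K_def using w L by simp
  have limK: "mat_tendsto (\<lambda>t. A ^\<^sub>m t) K"
    unfolding K_def by (rule pow_limit_similar[OF wit lim])
  have "L = Q * K * P"
    using mat_tendsto_unique[OF lim pow_limit_similar[OF similar_mat_wit_sym[OF wit] limK] L] K w
    by simp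
  moreover have "outer_product_mat (Q * K * P)"
    using outer[OF limK] K w
    by (intro outer_product_mult_right[of _ n n _ n] outer_product_mult_left[of _ n n _ n]) auto
  ultimately show ?thesis by simp
qed

section \<open>Nonnegative fixed columns of a positive matrix\<close>

lemma positive_fixed_columns_proportional:
  fixes a l :: "nat \<Rightarrow> nat \<Rightarrow> real"
  assumes pos: "\<And>i j. i < n \<Longrightarrow> j < n \<Longrightarrow> 0 < a i j"
    and nonneg: "\<And>i j. i < n \<Longrightarrow> j < n \<Longrightarrow> 0 \<le> l i j"
    and fix_l: "\<And>i j. i < n \<Longrightarrow> j < n \<Longrightarrow> (\<Sum>k<n. a i k * l k j) = l i j"
  shows "\<exists>v f. \<forall>i<n. \<forall>j<n. l i j = v i * f j"
proof (cases "\<forall>i<n. \<forall>j<n. l i j = 0")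
  case True
  then show ?thesis by (intro exI[of _ "\<lambda>_. 0"]) auto
next
  case False
  then obtain i0 j0 where ij: "i0 < n" "j0 < n" "l i0 j0 > 0"
    using nonneg by (metis less_eq_real_def)
  \<comment> \<open>Any nonzero column can serve as the common direction.\<close>
  define v where "v i = l i j0" for i
  have v_pos: "v i > 0" if "i < n" for i
  proof -
    \<comment> \<open>Entry \<open>i\<close> of the fixed vector \<open>v\<close> is a sum of
      nonnegative terms, and the term at \<open>i0\<close> is positive.\<close>
    have "0 < a i i0 * l i0 j0" using that pos ij by simp
    also have "\<dots> \<le> (\<Sum>k<n. a i k * l k j0)"
      using ij that pos nonneg by (intro member_le_sum) (auto simp: less_imp_le)
    finally show ?thesis using fix_l that ij by (simp add: v_def)
  qed
  \<comment> \<open>The minimal ratio is the largest multiple of \<open>v\<close> that can be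
    subtracted from column \<open>j\<close> while keeping it nonnegative.\<close>
  define f where "f j = Min ((\<lambda>i. l i j / v i) ` {..<n})" for j
  have "l i j = v i * f j" if i: "i < n" and j: "j < n" for i j
  proof -
    have ne: "{..<n} \<noteq> {}" using ij(1) by auto
    define w where "w k = l k j - v k * f j" for k
    have "f j \<in> (\<lambda>i. l i j / v i) ` {..<n}"
      unfolding f_def using ne by (intro Min_in) auto
    then obtain i1 where i1: "i1 < n" "f j = l i1 j / v i1" by auto
    have w_nonneg: "w k \<ge> 0" if "k < n" for k
    proof -
      have "f j \<le> l k j / v k" unfolding f_def using that by (intro Min_le) auto
      then show ?thesis using v_pos[OF that] by (simp add: w_def field_simps)
    qed
    \<comment> \<open>The remainder \<open>w\<close> is again fixed and vanishes at the minimiser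
      \<open>i1\<close>. Row \<open>i1\<close> is therefore a vanishing sum of nonnegative terms,
      and its positive coefficients force all of \<open>w\<close> to be 0.\<close>
    have "(\<Sum>k<n. a i1 k * w k) = (\<Sum>k<n. a i1 k * l k j) - (\<Sum>k<n. a i1 k * l k j0) * f j"
      by (simp add: w_def v_def algebra_simps sum_subtractf sum_distrib_left)
    also have "\<dots> = 0"
      using fix_l[OF i1(1) j] fix_l[OF i1(1) ij(2)] i1 v_pos[OF i1(1)] by (simp add: v_def)
    finally have "a i1 i * w i = 0"
      using i i1 pos w_nonneg by (subst (asm) sum_nonneg_eq_0_iff) (auto simp: less_imp_le)
    then show ?thesis using pos[OF i1(1) i] by (simp add: w_def)
  qed
  then show ?thesis by blast
qed

section \<open>Paths and equivalence classes of factors\<close>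

lemma factor_rel_refl: "(i, i) \<in> factor_rel B"
  unfolding factor_rel_def by (auto intro!: exI[of _ "[i]"])

lemma factor_rel_step:
  assumes "(x, i) \<in> factor_rel B" and edge: "B $ k $ i \<noteq> 0 \<or> B $ i $ k \<noteq> 0"
  shows "(x, k) \<in> factor_rel B"
proof -
  obtain ks where ks: "ks \<noteq> []" "hd ks = x" "last ks = i"
    "\<And>r. r \<in> {1..<length ks} \<Longrightarrow>
      B $ (ks ! r) $ (ks ! (r - 1)) \<noteq> 0 \<or> B $ (ks ! (r - 1)) $ (ks ! r) \<noteq> 0"
    using assms(1) unfolding factor_rel_def by blast
  have "B $ ((ks @ [k]) ! r) $ ((ks @ [k]) ! (r - 1)) \<noteq> 0 \<or>
      B $ ((ks @ [k]) ! (r - 1)) $ ((ks @ [k]) ! r) \<noteq> 0" if "r \<in> {1..<length (ks @ [k])}" for r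
  proof (cases "r = length ks")
    case True
    then show ?thesis using ks(1,3) edge by (simp add: nth_append last_conv_nth)
  next
    case False
    then show ?thesis using ks(4)[of r] that by (auto simp: nth_append)
  qed
  then show ?thesis
    unfolding factor_rel_def using ks(1,2) by (auto intro!: exI[of _ "ks @ [k]"])
qed

text \<open>A nonzero entry in either direction would extend a path ending at \<open>i\<close> to
  \<open>k\<close>. This is the block-diagonal structure of \<open>B\<close>.\<close>

lemma factor_class_closed:
  assumes "C \<in> UNIV // factor_rel B" "i \<in> C" "k \<notin> C"
  shows "B $ i $ k = 0" "B $ k $ i = 0"
  using assms factor_rel_step[of _ i B k] by (auto elim!: quotientE)

text \<open>Without an edge between the two members, a path starting at one of them can never leave
  it: closedness of the class confines the next vertex to the pair, and the other member is
  excluded. So the path cannot connect them.\<close>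

lemma factor_class_pair_edge:
  assumes C: "{x, y} \<in> UNIV // factor_rel B" and "x \<noteq> y"
  shows "B $ x $ y \<noteq> 0 \<or> B $ y $ x \<noteq> 0"
proof (rule ccontr)
  assume no: "\<not> ?thesis"
  obtain z where z: "{x, y} = factor_rel B `` {z}" using C by (auto elim: quotientE)
  then have "z \<in> {x, y}" using factor_rel_refl by blast
  then obtain u where u: "{x, y} = {z, u}" "u \<noteq> z" using \<open>x \<noteq> y\<close> by blast
  have no': "B $ z $ u = 0" "B $ u $ z = 0" using no u by (auto simp: doubleton_eq_iff)
  have "(z, u) \<in> factor_rel B" using z u by auto
  then obtain ks where ks: "ks \<noteq> []" "hd ks = z" "last ks = u"
    "\<And>r. r \<in> {1..<length ks} \<Longrightarrow>
      B $ (ks ! r) $ (ks ! (r - 1)) \<noteq> 0 \<or> B $ (ks ! (r - 1)) $ (ks ! r) \<noteq> 0"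
    unfolding factor_rel_def by blast
  have "ks ! r = z" if "r < length ks" for r
    using that
  proof (induction r)
    case 0
    then show ?case using ks by (simp add: hd_conv_nth)
  next
    case (Suc r)
    then have "B $ (ks ! Suc r) $ z \<noteq> 0 \<or> B $ z $ (ks ! Suc r) \<noteq> 0"
      using ks(4)[of "Suc r"] by simp
    moreover from this have "ks ! Suc r \<in> {z, u}"
      using factor_class_closed[OF C, of z "ks ! Suc r"] u by auto
    ultimately show ?case using no' by auto
  qed
  then show False using ks u by (simp add: last_conv_nth)
qed

section \<open>Principal submatrices and their powers\<close>

lemma principal_submat_carrier:
  "principal_submat B xs \<in> carrier_mat (length xs) (length xs)"
  unfolding principal_submat_def by simp

lemma principal_submat_entry:
  "i < length xs \<Longrightarrow> j < length xs \<Longrightarrow>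
    principal_submat B xs $$ (i, j) = complex_of_real (B $ (xs ! i) $ (xs ! j))"
  unfolding principal_submat_def by simp

text \<open>Rows of \<open>B\<close> indexed by \<open>xs\<close> vanish outside \<open>xs\<close>,
  so the sum over intermediate indices reduces to \<open>set xs\<close> and can be reindexed by
  positions.\<close>

lemma principal_submat_mult:
  assumes "distinct xs" and zero: "\<And>i k. i \<in> set xs \<Longrightarrow> k \<notin> set xs \<Longrightarrow> B $ i $ k = 0"
  shows "principal_submat (B ** X) xs = principal_submat B xs * principal_submat X xs"
proof (rule eq_matI)
  fix i j assume "i < dim_row (principal_submat B xs * principal_submat X xs)"
    and "j < dim_col (principal_submat B xs * principal_submat X xs)"
  then have ij: "i < length xs" "j < length xs" by (auto simp: principal_submat_def)
  have "(B ** X) $ (xs ! i) $ (xs ! j) = (\<Sum>k\<in>UNIV. B $ (xs ! i) $ k * X $ k $ (xs ! j))"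
    by (simp add: matrix_matrix_mult_def)
  also have "\<dots> = (\<Sum>k\<in>set xs. B $ (xs ! i) $ k * X $ k $ (xs ! j))"
    using zero ij by (intro sum.mono_neutral_right) auto
  also have "\<dots> = (\<Sum>l<length xs. B $ (xs ! i) $ (xs ! l) * X $ (xs ! l) $ (xs ! j))"
    using bij_betw_nth[OF assms(1), of "{..<length xs}" "set xs"]
    by (intro sum.reindex_bij_betw[symmetric]) auto
  finally show "principal_submat (B ** X) xs $$ (i, j)
      = (principal_submat B xs * principal_submat X xs) $$ (i, j)"
    using ij by (simp add: mult_mat_entry[OF principal_submat_carrier principal_submat_carrier]
        principal_submat_entry)
qed (auto simp: principal_submat_def)

text \<open>This serves both for a class, where the vanishing comes from closedness, and for an
  enumeration of all indices, where it is vacuous.\<close>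

lemma principal_submat_mpow:
  assumes "distinct xs" "\<And>i k. i \<in> set xs \<Longrightarrow> k \<notin> set xs \<Longrightarrow> B $ i $ k = 0"
  shows "principal_submat (mpow B t) xs = principal_submat B xs ^\<^sub>m t"
proof (induction t)
  case 0
  show ?case
    \<comment> \<open>Distinctness puts equal indices only at equal positions, so the identity
      restricts to the identity.\<close>
    using assms(1)
    by (intro eq_matI)
      (auto simp: principal_submat_def Finite_Cartesian_Product.mat_def nth_eq_iff_index_eq)
next
  case (Suc t)
  then show ?case
    unfolding mpow.simps pow_mat_Suc_left[OF principal_submat_carrier]
    using principal_submat_mult[OF assms, where X = "mpow B t"] by simp
qed

text \<open>An intermediate index inside \<open>C\<close> gives two nonnegative factors by
  induction; one outside \<open>C\<close> meets a zero entry of \<open>B\<close>.\<close>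

lemma mpow_nonneg:
  assumes "\<And>i j. i \<in> C \<Longrightarrow> j \<in> C \<Longrightarrow> B $ i $ j \<ge> 0"
    and "\<And>i k. i \<in> C \<Longrightarrow> k \<notin> C \<Longrightarrow> B $ i $ k = 0" and "i \<in> C" "j \<in> C"
  shows "mpow B t $ i $ j \<ge> 0"
  using assms(3,4)
proof (induction t arbitrary: i)
  case 0
  then show ?case by (simp add: Finite_Cartesian_Product.mat_def)
next
  case (Suc t)
  have "B $ i $ k * mpow B t $ k $ j \<ge> 0" for k
    using Suc assms(1,2) by (cases "k \<in> C") auto
  then show ?case by (simp add: matrix_matrix_mult_def sum_nonneg)
qed

section \<open>Limits of the powers of a class\<close>

text \<open>With a nonzero off-diagonal coefficient, one row of the fixed-point equation expresses
  one coordinate as a multiple of the other; in dimension two this confines fixed vectors to a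
  line.\<close>

lemma solve_fixed_row:
  fixes a b x y :: "'a :: field"
  assumes "a * x + b * y = x" "b \<noteq> 0"
  shows "y = (1 - a) / b * x"
proof -
  have "y * b = (1 - a) * x" using assms(1) by (simp add: algebra_simps eq_diff_eq)
  then have "y = (1 - a) * x / b" using assms(2) by (simp add: nonzero_eq_divide_eq)
  then show ?thesis by simp
qed

lemma class_pow_limit_outer_product:
  fixes B :: "real ^ 'm ^ 'm"
  assumes C: "C \<in> UNIV // factor_rel B" and xs: "distinct xs" "set xs = C"
    and cases: "card C = 1 \<or> card C = 2 \<or> (\<forall>i\<in>C. \<forall>j\<in>C. B $ i $ j > 0)"
    and lim: "mat_tendsto (\<lambda>t. principal_submat B xs ^\<^sub>m t) L"
  shows "outer_product_mat L"
proof -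
  define n where "n = length xs"
  define A where "A = principal_submat B xs"
  have A: "A \<in> carrier_mat n n" unfolding A_def n_def by (rule principal_submat_carrier)
  note lim = lim[folded A_def]
  note L = mat_tendsto_pow_dim[OF lim A]
  have n: "n = card C" using xs distinct_card unfolding n_def by metis
  have fixL: "(\<Sum>k<n. A $$ (i, k) * L $$ (k, j)) = L $$ (i, j)" if "i < n" "j < n" for i j
    using mult_mat_entry[OF A L that] pow_limit_fixed[OF lim A] by simp
  have A_entry: "A $$ (i, j) = complex_of_real (B $ (xs ! i) $ (xs ! j))" if "i < n" "j < n" for i j
    using that unfolding A_def n_def by (rule principal_submat_entry)
  consider "n = 1" | "n = 2" | "\<forall>i\<in>C. \<forall>j\<in>C. B $ i $ j > 0" using cases n by blast
  then have "\<exists>v f. \<forall>i<n. \<forall>j<n. L $$ (i, j) = v i * f j"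
  proof cases
    case 1
    then show ?thesis by - (rule exI[of _ "\<lambda>_. 1"], rule exI[of _ "\<lambda>j. L $$ (0, j)"], auto)
  next
    case 2
    have row: "A $$ (i, 0) * L $$ (0, j) + A $$ (i, 1) * L $$ (1, j) = L $$ (i, j)"
      if "i < 2" "j < 2" for i j
      using fixL[of i j] that 2 by (simp add: numeral_2_eq_2)
    obtain x y where "xs = [x, y]"
      using 2 unfolding n_def by (auto simp: numeral_2_eq_2 length_Suc_conv)
    then have "B $ x $ y \<noteq> 0 \<or> B $ y $ x \<noteq> 0" and "xs ! 0 = x" "xs ! 1 = y"
      using factor_class_pair_edge[of x y B] C xs by auto
    then consider "A $$ (0, 1) \<noteq> 0" | "A $$ (1, 0) \<noteq> 0"
      using A_entry[of 0 1] A_entry[of 1 0] 2 by auto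
    then show ?thesis
    proof cases
      case 1
      \<comment> \<open>Fixed vectors are multiples of this vector, normalised to 1 at index 0; its
        other entry is read off row 0.\<close>
      let ?v = "\<lambda>i. if i = 0 then 1 else (1 - A $$ (0, 0)) / A $$ (0, 1)"
      show ?thesis
      proof (rule exI[of _ ?v], rule exI[of _ "\<lambda>j. L $$ (0, j)"], intro allI impI)
        fix i j assume ij: "i < n" "j < n"
        show "L $$ (i, j) = ?v i * L $$ (0, j)"
        proof (cases "i = 0")
          case False
          then have "i = 1" using ij 2 by simp
          then show ?thesis using solve_fixed_row[OF row[of 0 j] 1] ij 2 by simp
        qed simp
      qed
    next
      case c: 2
      \<comment> \<open>Here row 1 is solved for the entry at index 0, so the normalisation moves to
        index 1.\<close>
      let ?v = "\<lambda>i. if i = 0 then (1 - A $$ (1, 1)) / A $$ (1, 0) else 1"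
      show ?thesis
      proof (rule exI[of _ ?v], rule exI[of _ "\<lambda>j. L $$ (1, j)"], intro allI impI)
        fix i j assume ij: "i < n" "j < n"
        show "L $$ (i, j) = ?v i * L $$ (1, j)"
        proof (cases "i = 0")
          case True
          have "A $$ (1, 1) * L $$ (1, j) + A $$ (1, 0) * L $$ (0, j) = L $$ (1, j)"
            using row[of 1 j] ij 2 by (simp add: add.commute)
          from solve_fixed_row[OF this c] True show ?thesis by simp
        next
          case False
          then have "i = 1" using ij 2 by simp
          then show ?thesis by simp
        qed
      qed
    qed
  next
    case 3
    have in_C: "xs ! i \<in> C" if "i < n" for i using that xs unfolding n_def by auto
    \<comment> \<open>Comparing columns requires an order. The limit is real because it is an
      entrywise limit of powers of a real matrix, so its real parts carry all the
      information.\<close>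
    define l where "l i j = Re (L $$ (i, j))" for i j
    have conv: "(\<lambda>t. complex_of_real (mpow B t $ (xs ! i) $ (xs ! j))) \<longlonglongrightarrow> L $$ (i, j)"
      if "i < n" "j < n" for i j
    proof -
      have "A ^\<^sub>m t = principal_submat (mpow B t) xs" for t
        unfolding A_def using factor_class_closed[OF C] xs
        by (intro principal_submat_mpow[symmetric]) auto
      then show ?thesis
        using mat_tendsto_entry[OF lim L that] that unfolding n_def
        by (simp add: principal_submat_entry)
    qed
    have L_l: "L $$ (i, j) = complex_of_real (l i j)" if "i < n" "j < n" for i j
    proof -
      have "(\<lambda>t. Im (complex_of_real (mpow B t $ (xs ! i) $ (xs ! j)))) \<longlonglongrightarrow> Im (L $$ (i, j))"
        by (intro tendsto_intros conv that)
      then have "Im (L $$ (i, j)) = 0" by (simp add: LIMSEQ_const_iff)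
      then show ?thesis by (simp add: l_def complex_eq_iff)
    qed
    have "\<exists>v f. \<forall>i<n. \<forall>j<n. l i j = v i * f j"
    proof (rule positive_fixed_columns_proportional[of n "\<lambda>i j. B $ (xs ! i) $ (xs ! j)" l])
      show "0 < B $ (xs ! i) $ (xs ! j)" if "i < n" "j < n" for i j
        using 3 in_C that by blast
      show "0 \<le> l i j" if "i < n" "j < n" for i j
      proof -
        have "(\<lambda>t. Re (complex_of_real (mpow B t $ (xs ! i) $ (xs ! j)))) \<longlonglongrightarrow> l i j"
          unfolding l_def by (intro tendsto_intros conv that)
        moreover have "mpow B t $ (xs ! i) $ (xs ! j) \<ge> 0" for t
          using 3 factor_class_closed[OF C] in_C that
          by (intro mpow_nonneg[of C]) (auto simp: less_imp_le)
        ultimately show ?thesis by (intro LIMSEQ_le_const[of _ "l i j" 0]) auto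
      qed
      show "(\<Sum>k<n. B $ (xs ! i) $ (xs ! k) * l k j) = l i j" if "i < n" "j < n" for i j
      proof -
        have "complex_of_real (\<Sum>k<n. B $ (xs ! i) $ (xs ! k) * l k j)
            = (\<Sum>k<n. A $$ (i, k) * L $$ (k, j))"
          using that by (simp add: A_entry L_l)
        then show ?thesis using fixL[OF that] L_l[OF that] by (simp only: of_real_eq_iff)
      qed
    qed
    then obtain v f where "\<forall>i<n. \<forall>j<n. l i j = v i * f j" by blast
    then show ?thesis
      using L_l
      by - (rule exI[of _ "\<lambda>i. complex_of_real (v i)"],
          rule exI[of _ "\<lambda>j. complex_of_real (f j)"], auto)
  qed
  then show ?thesis unfolding outer_product_mat_def using L by auto
qed

text \<open>\<open>mpow B t\<close> is independent of any enumeration: convergence along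
  \<open>ys\<close>, which lists all indices, yields convergence of each of its entries, and the
  powers of the block are a selection of these.\<close>

lemma class_pow_convergent:
  fixes B :: "real ^ 'm ^ 'm"
  assumes C: "C \<in> UNIV // factor_rel B" and xs: "distinct xs" "set xs = C"
    and ys: "distinct ys" "set ys = UNIV"
    and lim: "mat_tendsto (\<lambda>t. principal_submat B ys ^\<^sub>m t) K"
  shows "\<exists>L. mat_tendsto (\<lambda>t. principal_submat B xs ^\<^sub>m t) L"
proof -
  note K = mat_tendsto_pow_dim[OF lim principal_submat_carrier]
  have pow_ys: "principal_submat B ys ^\<^sub>m t = principal_submat (mpow B t) ys" for t
    using ys by (intro principal_submat_mpow[symmetric]) auto
  have pow_xs: "principal_submat B xs ^\<^sub>m t = principal_submat (mpow B t) xs" for t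
    using factor_class_closed[OF C] xs by (intro principal_submat_mpow[symmetric]) auto
  have "\<exists>c. (\<lambda>t. complex_of_real (mpow B t $ i $ j)) \<longlonglongrightarrow> c" for i j
  proof -
    obtain a b where "a < length ys" "ys ! a = i" "b < length ys" "ys ! b = j"
      using ys by (metis UNIV_I in_set_conv_nth)
    then show ?thesis
      using mat_tendsto_entry[OF lim K, of a b] by (auto simp: pow_ys principal_submat_entry)
  qed
  then obtain c where c: "\<And>i j. (\<lambda>t. complex_of_real (mpow B t $ i $ j)) \<longlonglongrightarrow> c i j"
    by metis
  have "mat_tendsto (\<lambda>t. principal_submat B xs ^\<^sub>m t)
      (Matrix.mat (length xs) (length xs) (\<lambda>(a, b). c (xs ! a) (xs ! b)))"
    unfolding mat_tendsto_def pow_xs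
    using principal_submat_carrier c by (auto simp: principal_submat_entry)
  then show ?thesis by blast
qed

section \<open>Transfer to the Jordan forms\<close>

lemma is_jordan_form_of_wit:
  assumes "is_jordan_form_of J A"
  obtains P Q where "similar_mat_wit A J P Q"
  using assms unfolding is_jordan_form_of_def jordan_nf_def similar_mat_def by blast

text \<open>The rank bound is first proved for any limit of the powers of \<open>Dr\<close>.
  Existence of that limit is then derived from the existence of the limit for the whole matrix,
  whatever the enumeration of the factors and the order of the Jordan blocks in
  \<open>D\<close>.\<close>

theorem mainTheorem3:
  fixes M :: "'a measure" and N1 :: "'b measure" and N2 :: "'c measure"
    and Y :: "nat \<Rightarrow> 'a \<Rightarrow> real ^ 'p"
    and \<eta> :: "nat \<Rightarrow> 'a \<Rightarrow> real ^ 'm"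
    and \<epsilon> :: "'a \<Rightarrow> real ^ 'p"
    and W :: "nat \<Rightarrow> 'a \<Rightarrow> real ^ 'm"
    and Ystar :: "'b \<Rightarrow> real ^ 'p"
    and Wstar :: "'c \<Rightarrow> real ^ 'm"
    and \<Lambda> :: "real ^ 'm ^ 'p"
    and B :: "real ^ 'm ^ 'm"
    and C :: "'m set" and xs :: "'m list"
    and Dr :: "complex mat"
  assumes "prob_space M" and "prob_space N1" and "prob_space N2"
    and Y_rv: "\<And>t. Y t \<in> borel_measurable M"
    and eta_rv: "\<And>t. \<eta> t \<in> borel_measurable M"
    and eps_normal: "\<And>i. normal_rv M (\<lambda>\<omega>. \<epsilon> \<omega> $ i)"
    and eps_indep: "prob_space.indep_vars M (\<lambda>_. borel) (\<lambda>i \<omega>. \<epsilon> \<omega> $ i) UNIV"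
    and W_normal: "\<And>t. t \<ge> 1 \<Longrightarrow> normal_rvec M (W t)"
    and W_indep: "prob_space.indep_vars M (\<lambda>_. borel) W {1..}"
    and Y_eq: "\<And>t \<omega>. \<omega> \<in> space M \<Longrightarrow> Y t \<omega> = \<Lambda> *v \<eta> t \<omega> + \<epsilon> \<omega>"
    and eta_eq: "\<And>t \<omega>. t \<ge> 1 \<Longrightarrow> \<omega> \<in> space M \<Longrightarrow> \<eta> t \<omega> = B *v \<eta> (t - 1) \<omega> + W t \<omega>"
    and Ystar_rv: "Ystar \<in> borel_measurable N1"
    and Y_conv: "conv_in_distr M Y N1 Ystar"
    and B_inv: "invertible B"
    and Wstar_normal: "normal_rvec N2 Wstar"
    and W_conv: "conv_in_distr M (\<lambda>t \<omega>. \<Sum>k=1..t. mpow (matrix_inv B) k *v W k \<omega>) N2 Wstar"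
    and C_class: "C \<in> UNIV // factor_rel B"
    and C_enum: "distinct xs" "set xs = C"
    and Dr_jnf: "is_jordan_form_of Dr (principal_submat B xs)"
    and C_cases: "card C = 1 \<or> card C = 2 \<or> (\<forall>i\<in>C. \<forall>j\<in>C. B $ i $ j > 0)"
  shows "(\<forall>L. mat_tendsto (\<lambda>t. Dr ^\<^sub>m t) L \<longrightarrow> mat_rank L \<le> 1) \<and>
    (\<forall>ys D Dstar. distinct ys \<and> set ys = UNIV \<and> is_jordan_form_of D (principal_submat B ys) \<and>
       mat_tendsto (\<lambda>t. D ^\<^sub>m t) Dstar \<longrightarrow>
       (\<exists>L. mat_tendsto (\<lambda>t. Dr ^\<^sub>m t) L \<and> mat_rank L \<le> 1))"
proof -
  obtain P Q where wit: "similar_mat_wit (principal_submat B xs) Dr P Q"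
    using is_jordan_form_of_wit[OF Dr_jnf] .
  have rank: "mat_rank L \<le> 1" if "mat_tendsto (\<lambda>t. Dr ^\<^sub>m t) L" for L
    using class_pow_limit_outer_product[OF C_class C_enum C_cases]
    by (intro mat_rank_le_1 outer_product_pow_limit_similar[OF wit that])
  have "\<exists>L. mat_tendsto (\<lambda>t. Dr ^\<^sub>m t) L"
    if ys: "distinct ys" "set ys = UNIV" and D: "is_jordan_form_of D (principal_submat B ys)"
      and lim: "mat_tendsto (\<lambda>t. D ^\<^sub>m t) Dstar" for ys D Dstar
  proof -
    obtain P' Q' where "similar_mat_wit (principal_submat B ys) D P' Q'"
      using is_jordan_form_of_wit[OF D] .
    \<comment> \<open>Convergence passes from \<open>D\<close> to \<open>B\<close> by similarity,
      from \<open>B\<close> to its block by restriction, and from the block to \<open>Dr\<close> by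
      the inverse similarity.\<close>
    from pow_limit_similar[OF this lim] show ?thesis
      using class_pow_convergent[OF C_class C_enum ys]
        pow_limit_similar[OF similar_mat_wit_sym[OF wit]] by blast
  qed
  with rank show ?thesis by blast
qed

end
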